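(* Consider the big picture $\mathfrak{P}$ as a subgraph of $\mathfrak{M}=\mathrm{GL}_2(\mathbb{Z})\backslash \mathrm{M}_2^{\mathrm{ns}}(\mathbb{Z})$. Then its zeta function is given by $$\zeta_{\mathfrak{P}}(s)=\sum_{x\in\mathfrak{P}}\det(x)^{-s}=\frac{\zeta(s)\zeta(s-1)}{\zeta(2s)}$$ (as Dirichlet series), where $\zeta$ is the Riemann zeta function.
   Context: $\mathrm{M}_2^{\mathrm{ns}}(\mathbb{Z})$ is the monoid of $2\times2$ integer matrices with nonzero determinant. For a class $x\in\mathfrak{M}$, $\det(x)$ denotes the absolute value of the determinant of a representative (a positive integer). Conway's big picture has vertex set $\mathbb{Q}_+\times\mathbb{Q}/\mathbb{Z}$ and is embedded in $\mathfrak{M}$ by $(M,\frac gh)\mapsto\begin{pmatrix}MN&\frac ghN\\0&N\end{pmatrix}$, with $0\le\frac gh<1$ and $N$ the minimal positive integer making all entries integral. As a subset of $\mathfrak{M}$, $\mathfrak{P}$ is the set of classes of matrices whose four entries have greatest common divisor $1$. *)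

theory Defs
  imports "HOL-Analysis.Analysis"
begin

definition M2ns :: "(int^2^2) set" where
  "M2ns = {A. det A \<noteq> 0}"

text \<open>Over the integers, \<^const>\<open>invertible\<close> asks for an integral inverse, so the matrices
  \<open>U\<close> below range over GL(2,Z).\<close>

definition gl2_rel :: "((int^2^2) \<times> (int^2^2)) set" where
  "gl2_rel = {(A, B). A \<in> M2ns \<and> B \<in> M2ns \<and> (\<exists>U. invertible U \<and> B = U ** A)}"

definition mat_classes :: "(int^2^2) set set" where
  "mat_classes = M2ns // gl2_rel"

definition class_det :: "(int^2^2) set \<Rightarrow> nat" where
  "class_det x = the_elem ((\<lambda>A. nat \<bar>det A\<bar>) ` x)"

definition rat_mod_int :: "rat set set" where
  "rat_mod_int = UNIV // {(q, r). q - r \<in> \<int>}"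

definition unit_rep :: "rat set \<Rightarrow> rat" where
  "unit_rep c = (THE r. r \<in> c \<and> 0 \<le> r \<and> r < 1)"

definition big_picture_vertices :: "(rat \<times> rat set) set" where
  "big_picture_vertices = {M. 0 < M} \<times> rat_mod_int"

text \<open>A class in Q/Z is a coset, and \<^const>\<open>unit_rep\<close> picks its representative in [0,1).
  The entries below are integers by the choice of \<open>N\<close>; \<^const>\<open>floor\<close> only serves to
  change their type.\<close>

definition vertex_matrix :: "rat \<times> rat set \<Rightarrow> int^2^2" where
  "vertex_matrix = (\<lambda>(M, c).
     let r = unit_rep c;
         N = (LEAST N::nat. 0 < N \<and> M * of_nat N \<in> \<int> \<and> r * of_nat N \<in> \<int>)
     in vector [vector [\<lfloor>M * of_nat N\<rfloor>, \<lfloor>r * of_nat N\<rfloor>], vector [0, int N]])"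

definition big_picture :: "(int^2^2) set set" where
  "big_picture = (\<lambda>v. gl2_rel `` {vertex_matrix v}) ` big_picture_vertices"

lemma det_eq: "det (A :: int^2^2) = A$1$1 * A$2$2 - A$1$2 * A$2$1"
  by (simp add: det_2)

lemma invertible_det_int:
  assumes "det (U :: int^2^2) = 1"
  shows "invertible U"
proof -
  let ?V = "vector [vector [U$2$2, - U$1$2], vector [- U$2$1, U$1$1]] :: int^2^2"
  have "U ** ?V = mat 1" "?V ** U = mat 1"
    using assms
    by (auto simp: det_eq vec_eq_iff forall_2 matrix_matrix_mult_def sum_2 mat_def algebra_simps)
  then show ?thesis
    unfolding invertible_def by blast
qed

lemma det_invertible_int:
  assumes "invertible (U :: int^2^2)"
  shows "\<bar>det U\<bar> = 1"
proof -
  obtain V where "U ** V = mat 1"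
    using assms unfolding invertible_def by blast
  then have "det (U ** V) = 1"
    by simp
  then have "is_unit (det U)"
    unfolding det_mul by (rule dvdI[OF sym])
  then show ?thesis
    by (simp only: zdvd1_eq)
qed

lemma equiv_gl2_rel: "equiv M2ns gl2_rel"
proof (rule equivI)
  show "refl_on M2ns gl2_rel"
    unfolding refl_on_def gl2_rel_def
    by (auto intro!: exI[of _ "mat 1"] simp: invertible_def)
  show "gl2_rel \<subseteq> M2ns \<times> M2ns"
    unfolding gl2_rel_def by auto
  show "sym gl2_rel"
  proof (rule symI)
    fix A B assume "(A, B) \<in> gl2_rel"
    then obtain U V where *: "A \<in> M2ns" "B \<in> M2ns" "B = U ** A" "U ** V = mat 1" "V ** U = mat 1"
      unfolding gl2_rel_def invertible_def by blast
    then have "A = V ** B" "invertible V"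
      by (simp add: matrix_mul_assoc) (use * in \<open>unfold invertible_def, blast\<close>)
    then show "(B, A) \<in> gl2_rel"
      using *(1,2) unfolding gl2_rel_def by blast
  qed
  show "trans gl2_rel"
  proof (rule transI)
    fix A B C assume AB: "(A, B) \<in> gl2_rel" and BC: "(B, C) \<in> gl2_rel"
    obtain U where U: "A \<in> M2ns" "B = U ** A" "invertible U"
      using AB unfolding gl2_rel_def by blast
    obtain V where V: "C \<in> M2ns" "C = V ** B" "invertible V"
      using BC unfolding gl2_rel_def by blast
    have "C = (V ** U) ** A" "invertible (V ** U)"
      using U V by (simp_all add: matrix_mul_assoc invertible_mult)
    then show "(A, C) \<in> gl2_rel"
      using U(1) V(1) unfolding gl2_rel_def by blast
  qed
qed

lemma gl2_rel_sym: "(A, B) \<in> gl2_rel \<Longrightarrow> (B, A) \<in> gl2_rel"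
  using equiv_gl2_rel by (metis equivE symD)

lemma gl2_rel_trans: "(A, B) \<in> gl2_rel \<Longrightarrow> (B, C) \<in> gl2_rel \<Longrightarrow> (A, C) \<in> gl2_rel"
  using equiv_gl2_rel by (metis equivE transD)

lemma class_det_eq:
  assumes "A \<in> M2ns"
  shows "class_det (gl2_rel `` {A}) = nat \<bar>det A\<bar>"
proof -
  have "\<bar>det B\<bar> = \<bar>det A\<bar>" if "(A, B) \<in> gl2_rel" for B
  proof -
    from that obtain U where "B = U ** A" "invertible U"
      unfolding gl2_rel_def by blast
    then show ?thesis
      by (simp only: det_mul abs_mult det_invertible_int mult_1)
  qed
  then have "(\<lambda>A. nat \<bar>det A\<bar>) ` (gl2_rel `` {A}) = (\<lambda>_. nat \<bar>det A\<bar>) ` (gl2_rel `` {A})"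
    by (intro image_cong) simp_all
  also have "\<dots> = {nat \<bar>det A\<bar>}"
    using equiv_class_self[OF equiv_gl2_rel assms] by (rule image_constant)
  finally have "(\<lambda>A. nat \<bar>det A\<bar>) ` (gl2_rel `` {A}) = {nat \<bar>det A\<bar>}" .
  then show ?thesis
    unfolding class_det_def by simp
qed

definition primitive :: "int^2^2 \<Rightarrow> bool" where
  "primitive A \<longleftrightarrow> Gcd {A$i$j | i j. True} = 1"

lemma primitive_iff: "primitive A \<longleftrightarrow> (\<forall>k. (\<forall>i j. k dvd A$i$j) \<longrightarrow> is_unit k)"
proof -
  have dvd_iff: "k dvd Gcd {A$i$j | i j. True} \<longleftrightarrow> (\<forall>i j. k dvd A$i$j)" for k
    by (auto simp: dvd_Gcd_iff)
  have "Gcd {A$i$j | i j. True} = 1 \<longleftrightarrow> is_unit (Gcd {A$i$j | i j. True})"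
    using Gcd_int_greater_eq_0[of "{A$i$j | i j. True}"] by (simp add: zdvd1_eq)
  also have "\<dots> \<longleftrightarrow> (\<forall>k. k dvd Gcd {A$i$j | i j. True} \<longrightarrow> is_unit k)"
    by (meson dvd_refl dvd_trans)
  finally show ?thesis
    unfolding primitive_def dvd_iff .
qed

lemma primitive_gl2_rel:
  assumes "(A, B) \<in> gl2_rel" "primitive A"
  shows "primitive B"
  unfolding primitive_iff
proof (intro allI impI)
  fix k assume k: "\<forall>i j. k dvd B$i$j"
  obtain V where "A = V ** B"
    using gl2_rel_sym[OF assms(1)] unfolding gl2_rel_def by blast
  then have "\<forall>i j. k dvd A$i$j"
    using k by (auto simp: matrix_matrix_mult_def intro!: dvd_sum)
  then show "is_unit k"
    using assms(2) unfolding primitive_iff by blast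
qed

lemma hermite_form:
  assumes A: "A \<in> M2ns"
  shows "\<exists>a b d. 0 < a \<and> 0 \<le> b \<and> b < d \<and> (A, vector [vector [a, b], vector [0, d]]) \<in> gl2_rel"
proof -
  have trans: "(A, C) \<in> gl2_rel" if "(A, B) \<in> gl2_rel" "C = U ** B" "invertible U" for B C U
  proof -
    have "det C \<noteq> 0"
      using that det_invertible_int[of U] by (auto simp: gl2_rel_def M2ns_def det_mul)
    then have "(B, C) \<in> gl2_rel"
      using that unfolding gl2_rel_def M2ns_def by blast
    then show ?thesis
      using that(1) gl2_rel_trans by blast
  qed
  define g where "g = gcd (A$1$1) (A$2$1)"
  have "A$1$1 \<noteq> 0 \<or> A$2$1 \<noteq> 0"
    using A by (auto simp: M2ns_def det_eq)
  then have g: "g > 0"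
    by (simp add: g_def)
  obtain u v where uv: "u * A$1$1 + v * A$2$1 = g"
    using bezout_int[of "A$1$1" "A$2$1"] unfolding g_def by blast
  obtain p q where p: "A$1$1 = g * p" and q: "A$2$1 = g * q"
    unfolding g_def by (meson dvdE gcd_dvd1 gcd_dvd2)
  have "g * (u * p + v * q) = g * 1"
    using uv by (simp add: p q algebra_simps)
  then have pq: "u * p + v * q = 1"
    using g by simp
  define U :: "int^2^2" where "U = vector [vector [u, v], vector [-q, p]]"
  define B where "B = U ** A"
  have "invertible U"
    by (rule invertible_det_int) (use pq in \<open>simp add: U_def det_eq algebra_simps\<close>)
  then have AB: "(A, B) \<in> gl2_rel"
    by (intro trans[of A B U]) (use A equiv_class_self[OF equiv_gl2_rel A] in \<open>simp_all add: B_def\<close>)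
  have B: "B$1$1 = g" "B$2$1 = 0"
    using uv by (simp_all add: B_def U_def matrix_matrix_mult_def sum_2 p q)
  have "B$2$2 \<noteq> 0"
    using AB B by (auto simp: gl2_rel_def M2ns_def det_eq)
  define e where "e = sgn (B$2$2)"
  have e: "e * e = 1"
    using \<open>B$2$2 \<noteq> 0\<close> by (auto simp: e_def sgn_if)
  define d where "d = e * B$2$2"
  have d: "d > 0"
    using \<open>B$2$2 \<noteq> 0\<close> by (auto simp: d_def e_def sgn_if)
  define k where "k = B$1$2 div d"
  define W :: "int^2^2" where "W = vector [vector [1, -k * e], vector [0, e]]"
  have "W ** vector [vector [1, k], vector [0, e]] = mat 1"
    "vector [vector [1, k], vector [0, e]] ** W = mat 1"
    using e by (auto simp: W_def vec_eq_iff forall_2 matrix_matrix_mult_def sum_2 mat_def algebra_simps)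
  then have "invertible W"
    unfolding invertible_def by blast
  moreover have "vector [vector [g, B$1$2 mod d], vector [0, d]] = W ** B"
    using B by (auto simp: W_def vec_eq_iff forall_2 matrix_matrix_mult_def sum_2 k_def d_def
        minus_div_mult_eq_mod[symmetric] algebra_simps)
  ultimately have "(A, vector [vector [g, B$1$2 mod d], vector [0, d]]) \<in> gl2_rel"
    using AB trans by blast
  then show ?thesis
    using g d by (meson pos_mod_bound pos_mod_sign)
qed

lemma unit_rep_eqI:
  assumes "r \<in> c" "c \<in> rat_mod_int" "0 \<le> r" "r < 1"
  shows "unit_rep c = r"
  unfolding unit_rep_def
proof (rule the_equality)
  fix r' assume r': "r' \<in> c \<and> 0 \<le> r' \<and> r' < 1"
  obtain q where "q - r \<in> \<int>" "q - r' \<in> \<int>"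
    using assms(1,2) r' unfolding rat_mod_int_def quotient_def by auto
  then have "r - r' \<in> \<int>"
    by (metis Ints_diff diff_diff_eq2 add_diff_cancel_left' diff_add_cancel)
  then obtain n where "r - r' = of_int n"
    by (auto elim: Ints_cases)
  moreover from this have "\<bar>of_int n :: rat\<bar> < of_int 1"
    using assms(3,4) r' by linarith
  then have "n = 0"
    by linarith
  ultimately show "r' = r"
    by simp
qed (use assms in auto)

lemma unit_rep:
  assumes "c \<in> rat_mod_int"
  shows "unit_rep c \<in> c" "0 \<le> unit_rep c" "unit_rep c < 1"
proof -
  obtain q where q: "c = {(q, r). q - r \<in> \<int>} `` {q}"
    using assms unfolding rat_mod_int_def quotient_def by auto
  have "frac q \<in> c"
    by (simp add: q frac_def)
  then have "unit_rep c = frac q"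
    by (intro unit_rep_eqI assms) (auto simp: frac_ge_0 frac_lt_1)
  then show "unit_rep c \<in> c" "0 \<le> unit_rep c" "unit_rep c < 1"
    using \<open>frac q \<in> c\<close> by (auto simp: frac_ge_0 frac_lt_1)
qed

lemma vertex_matrix_primitive:
  assumes "v \<in> big_picture_vertices"
  shows "vertex_matrix v \<in> M2ns" "primitive (vertex_matrix v)"
proof -
  obtain M c where v: "v = (M, c)" "M > 0" "c \<in> rat_mod_int"
    using assms unfolding big_picture_vertices_def by auto
  define r where "r = unit_rep c"
  define P where "P = (\<lambda>N::nat. 0 < N \<and> M * of_nat N \<in> \<int> \<and> r * of_nat N \<in> \<int>)"
  define N where "N = (LEAST N. P N)"
  define B where "B = (vector [vector [\<lfloor>M * of_nat N\<rfloor>, \<lfloor>r * of_nat N\<rfloor>], vector [0, int N]] :: int^2^2)"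
  have B_eq: "vertex_matrix v = B"
    unfolding vertex_matrix_def v B_def N_def P_def r_def by (simp add: Let_def)
  obtain m n k l :: int where mn: "M = of_int m / of_int n" "n > 0" "r = of_int k / of_int l" "l > 0"
    by (metis quotient_of_denom_pos quotient_of_div surj_pair)
  have "M * of_nat (nat (n * l)) = of_int (m * l)" "r * of_nat (nat (n * l)) = of_int (k * n)"
    using mn by (simp_all add: field_simps)
  then have "P (nat (n * l))"
    unfolding P_def using mn by (metis Ints_of_int zero_less_mult_iff zero_less_nat_eq)
  then have "P N"
    unfolding N_def by (rule LeastI)
  then have N: "N > 0" "M * of_nat N \<in> \<int>" "r * of_nat N \<in> \<int>"
    by (simp_all add: P_def)
  then have floor: "of_int \<lfloor>M * of_nat N\<rfloor> = M * of_nat N" "of_int \<lfloor>r * of_nat N\<rfloor> = r * of_nat N"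
    by (auto elim!: Ints_cases)
  have "of_int \<lfloor>M * of_nat N\<rfloor> \<noteq> (0 :: rat)"
    unfolding floor using N(1) \<open>M > 0\<close> by simp
  then show "vertex_matrix v \<in> M2ns"
    using N(1) by (simp add: B_eq M2ns_def det_eq B_def)
  show "primitive (vertex_matrix v)"
    unfolding primitive_iff B_eq
  proof (intro allI impI)
    fix k assume "\<forall>i j. k dvd B$i$j"
    then have "\<bar>k\<bar> dvd B$1$1" "\<bar>k\<bar> dvd B$1$2" "\<bar>k\<bar> dvd B$2$2"
      by simp_all
    then obtain x y z where xyz: "\<lfloor>M * of_nat N\<rfloor> = \<bar>k\<bar> * x" "\<lfloor>r * of_nat N\<rfloor> = \<bar>k\<bar> * y" "int N = \<bar>k\<bar> * z"
      unfolding B_def vector_2 dvd_def by blast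
    have "0 < \<bar>k\<bar> * z"
      using xyz(3) N(1) by simp
    then have kz: "k \<noteq> 0" "z > 0"
      by (simp_all add: zero_less_mult_iff)
    have "(of_nat N :: rat) = of_int (int N)"
      by simp
    also have "\<dots> = of_int \<bar>k\<bar> * of_int z"
      unfolding xyz(3) by simp
    finally have Nz: "(of_nat N :: rat) = of_int \<bar>k\<bar> * of_int z" .
    have "of_int \<bar>k\<bar> * (M * of_int z) = of_int \<bar>k\<bar> * (of_int x :: rat)"
         "of_int \<bar>k\<bar> * (r * of_int z) = of_int \<bar>k\<bar> * (of_int y :: rat)"
      using floor(1)[unfolded xyz(1), unfolded Nz] floor(2)[unfolded xyz(2), unfolded Nz]
      by (simp_all only: of_int_mult mult_ac)
    then have "M * of_int z = of_int x" "r * of_int z = of_int y"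
      using kz(1) by simp_all
    then have "P (nat z)"
      using kz(2) by (simp add: P_def)
    then have "N \<le> nat z"
      unfolding N_def by (rule Least_le)
    then have "\<bar>k\<bar> * z \<le> 1 * z"
      using xyz(3) kz by linarith
    then have "\<bar>k\<bar> \<le> 1"
      using kz(2) by (simp add: mult_le_cancel_right)
    then show "is_unit k"
      using kz(1) by (simp add: zdvd1_eq)
  qed
qed

lemma primitive_vertex_matrix:
  assumes "0 < a" "0 \<le> b" "b < d" and prim: "primitive (vector [vector [a, b], vector [0, d]])"
  shows "\<exists>v \<in> big_picture_vertices. vertex_matrix v = vector [vector [a, b], vector [0, d]]"
proof
  define M r :: rat where "M = of_int a / of_int d" and "r = of_int b / of_int d"
  define c where "c = {(q, r :: rat). q - r \<in> \<int>} `` {r}"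
  have c: "c \<in> rat_mod_int" "r \<in> c"
    unfolding c_def rat_mod_int_def by (rule quotientI) auto
  then have r: "unit_rep c = r"
    by (intro unit_rep_eqI) (use assms in \<open>auto simp: r_def\<close>)
  show "(M, c) \<in> big_picture_vertices"
    using c assms by (simp add: big_picture_vertices_def M_def)
  have "(LEAST N::nat. 0 < N \<and> M * of_nat N \<in> \<int> \<and> r * of_nat N \<in> \<int>) = nat d"
  proof (rule Least_equality)
    fix N :: nat assume N: "0 < N \<and> M * of_nat N \<in> \<int> \<and> r * of_nat N \<in> \<int>"
    then obtain x y where "M * of_nat N = of_int x" "r * of_nat N = of_int y"
      by (auto elim!: Ints_cases)
    then have "(of_int (a * int N) :: rat) = of_int (d * x)" "(of_int (b * int N) :: rat) = of_int (d * y)"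
      using assms by (simp_all add: M_def r_def field_simps)
    then have "d dvd a * int N" "d dvd b * int N"
      unfolding of_int_eq_iff by simp_all
    then have *: "d dvd gcd (a * int N) (gcd (b * int N) (d * int N))"
      by simp
    let ?g = "gcd a (gcd b d)"
    have "?g dvd a" "?g dvd b" "?g dvd d"
      by (meson dvd_trans gcd_dvd1 gcd_dvd2)+
    then have "\<forall>i j. ?g dvd (vector [vector [a, b], vector [0, d]] :: int^2^2) $ i $ j"
      by (simp only: forall_2 vector_2 dvd_0_right simp_thms)
    then have "is_unit ?g"
      using prim unfolding primitive_iff by blast
    then have "?g = 1"
      by simp
    moreover have "gcd (a * int N) (gcd (b * int N) (d * int N)) = ?g * int N"
      by (simp add: gcd_mult_right gcd.commute gcd.left_commute gcd.assoc)
    ultimately have "d dvd int N"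
      using * by simp
    then show "nat d \<le> N"
      using N by (auto dest: zdvd_imp_le)
  qed (use assms in \<open>simp add: M_def r_def\<close>)
  then show "vertex_matrix (M, c) = vector [vector [a, b], vector [0, d]]"
    using assms by (simp add: vertex_matrix_def Let_def r) (simp add: M_def r_def)
qed

theorem big_picture_eq:
  "big_picture = (\<lambda>A. gl2_rel `` {A}) ` {A \<in> M2ns. primitive A}"
proof
  show "big_picture \<subseteq> (\<lambda>A. gl2_rel `` {A}) ` {A \<in> M2ns. primitive A}"
    unfolding big_picture_def using vertex_matrix_primitive by blast
  show "(\<lambda>A. gl2_rel `` {A}) ` {A \<in> M2ns. primitive A} \<subseteq> big_picture"
  proof clarify
    fix A assume A: "A \<in> M2ns" "primitive A"
    obtain a b d where abd: "0 < a" "0 \<le> b" "b < d" "(A, vector [vector [a, b], vector [0, d]]) \<in> gl2_rel"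
      using hermite_form[OF A(1)] by blast
    then obtain v where "v \<in> big_picture_vertices" "(A, vertex_matrix v) \<in> gl2_rel"
      using primitive_vertex_matrix[OF abd(1-3)] primitive_gl2_rel[OF abd(4) A(2)] by metis
    then show "gl2_rel `` {A} \<in> big_picture"
      unfolding big_picture_def using equiv_class_eq[OF equiv_gl2_rel] by blast
  qed
qed

corollary big_picture_subset: "big_picture \<subseteq> mat_classes"
  unfolding big_picture_eq mat_classes_def by (auto intro: quotientI)

text \<open>The defining series of the Riemann zeta function; it is the zeta function on the
  half-plane \<open>Re s > 1\<close> only (no analytic continuation is built in).\<close>

definition zeta :: "complex \<Rightarrow> complex" where
  "zeta s = (\<Sum>n. of_nat (Suc n) powr (-s))"

definition big_picture_zeta :: "complex \<Rightarrow> complex" where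
  "big_picture_zeta s = (\<Sum>\<^sub>\<infinity>x\<in>big_picture. of_nat (class_det x) powr (-s))"

text \<open>A formal Dirichlet series, the sum over \<open>n \<ge> 1\<close> of \<open>f n * n powr (-s)\<close>, is given by its
  coefficient function \<open>f\<close>; the value \<open>f 0\<close> is irrelevant.\<close>

definition dirichlet_mult :: "(nat \<Rightarrow> complex) \<Rightarrow> (nat \<Rightarrow> complex) \<Rightarrow> nat \<Rightarrow> complex" where
  "dirichlet_mult f g n = (\<Sum>d | d dvd n. f d * g (n div d))"

text \<open>The quotient \<open>h\<close> of \<open>f\<close> by \<open>g\<close> (for \<open>g 1 \<noteq> 0\<close>) is the solution of
  \<open>dirichlet_mult h g = f\<close>, solved for \<open>h n\<close>.\<close>

function dirichlet_divide :: "(nat \<Rightarrow> complex) \<Rightarrow> (nat \<Rightarrow> complex) \<Rightarrow> nat \<Rightarrow> complex" where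
  "dirichlet_divide f g n =
     (f n - (\<Sum>d | d dvd n \<and> d < n. dirichlet_divide f g d * g (n div d))) / g 1"
  by auto
termination by (relation "Wellfounded.measure (\<lambda>(_, _, n). n)") auto

declare dirichlet_divide.simps [simp del]

lemma dirichlet_mult_divide:
  assumes "g 1 \<noteq> 0" "n > 0"
  shows "dirichlet_mult (dirichlet_divide f g) g n = f n"
proof -
  have *: "{d. d dvd n} = insert n {d. d dvd n \<and> d < n}"
    using assms(2) by (auto dest: dvd_imp_le intro: le_neq_trans)
  show ?thesis
    unfolding dirichlet_mult_def * using assms
    by (subst sum.insert) (auto simp: dirichlet_divide.simps[of f g n])
qed

definition zeta_series :: "nat \<Rightarrow> complex" where
  "zeta_series n = 1"

text \<open>Replacing \<open>s\<close> by \<open>s - k\<close> multiplies the \<open>n\<close>-th coefficient by \<open>n ^ k\<close>;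
  replacing \<open>s\<close> by \<open>k * s\<close> (with \<open>k \<ge> 1\<close>) moves the \<open>n\<close>-th coefficient to position \<open>n ^ k\<close>.\<close>

definition dirichlet_shift :: "nat \<Rightarrow> (nat \<Rightarrow> complex) \<Rightarrow> nat \<Rightarrow> complex" where
  "dirichlet_shift k f n = of_nat n ^ k * f n"

definition dirichlet_scale :: "nat \<Rightarrow> (nat \<Rightarrow> complex) \<Rightarrow> nat \<Rightarrow> complex" where
  "dirichlet_scale k f n = (\<Sum>m | m ^ k = n. f m)"

definition big_picture_series :: "nat \<Rightarrow> complex" where
  "big_picture_series n = of_nat (card {x \<in> big_picture. class_det x = n})"

end

theory Submission
  imports Defs
begin

text \<open>
  Every class of integer matrices of nonzero determinant contains exactly one upper triangular
  matrix with rows \<open>(a, b)\<close> and \<open>(0, d)\<close> where \<open>a, d > 0\<close> and \<open>0 \<le> b < d\<close>, its Hermite normal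
  form. The vertices of the big picture are the classes of the primitive normal forms, those with
  \<open>gcd(a, b, d) = 1\<close> (\<open>bij_betw_big_picture\<close>). The whole argument is a comparison of all normal
  forms with the primitive ones.

  Dividing a normal form by the gcd \<open>k\<close> of its entries writes it in a unique way as \<open>k\<close> times a
  primitive normal form (\<open>bij_betw_hnf_scale\<close>), and multiplication by \<open>k\<close> multiplies the
  determinant by \<open>k\<^sup>2\<close>. The sum of \<open>det powr (-s)\<close> over all normal forms is therefore
  \<open>zeta(2s)\<close> times the sum over the big picture. On the other hand that sum can be computed
  directly: the determinant is \<open>a * d\<close>, and there are \<open>d\<close> choices of \<open>b\<close>, so it is the product of
  the sum of \<open>a powr (-s)\<close> and the sum of \<open>d * d powr (-s)\<close>, that is \<open>zeta(s) * zeta(s - 1)\<close>.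

  Both parts of the theorem follow this argument. For formal series it is a count of the normal
  forms of a fixed determinant (\<open>dirichlet_mult_big_picture_series\<close>), after which the uniqueness of
  Dirichlet quotients applies (\<open>dirichlet_divide_unique\<close>). For functions on \<open>Re s > 2\<close> it is a
  rearrangement of absolutely convergent sums (\<open>big_picture_zeta_factorization\<close>). The final
  division by \<open>zeta(2s)\<close> is legitimate because, for \<open>Re s \<ge> 3\<close>, the terms of \<open>zeta(s)\<close> after the
  leading \<open>1\<close> have total absolute value at most \<open>1/2\<close> (\<open>zeta_nonzero\<close>).
\<close>

section \<open>Hermite normal forms\<close>

text \<open>The entry \<open>b\<close> comes last, after its bound \<open>d\<close>: so the index set is literally a product over
  \<open>a\<close> and a dependent sum over \<open>d\<close>, and both the count and the infinite sum factor accordingly.\<close>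

definition hnf_index :: "(nat \<times> nat \<times> nat) set" where
  "hnf_index = {0<..} \<times> (SIGMA d:{0<..}. {..<d})"

definition primitive_index :: "(nat \<times> nat \<times> nat) set" where
  "primitive_index = {(a, d, b) \<in> hnf_index. gcd a (gcd d b) = 1}"

definition hnf_det :: "nat \<times> nat \<times> nat \<Rightarrow> nat" where
  "hnf_det = (\<lambda>(a, d, b). a * d)"

definition hnf_matrix :: "nat \<times> nat \<times> nat \<Rightarrow> int^2^2" where
  "hnf_matrix = (\<lambda>(a, d, b). vector [vector [int a, int b], vector [0, int d]])"

definition hnf_scale :: "nat \<Rightarrow> nat \<times> nat \<times> nat \<Rightarrow> nat \<times> nat \<times> nat" where
  "hnf_scale k = (\<lambda>(a, d, b). (k * a, k * d, k * b))"

lemma det_hnf_matrix: "det (hnf_matrix t) = int (hnf_det t)"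
  by (cases t) (simp add: hnf_matrix_def hnf_det_def det_eq)

lemma hnf_det_pos: "t \<in> hnf_index \<Longrightarrow> 0 < hnf_det t"
  by (auto simp: hnf_index_def hnf_det_def)

lemma hnf_matrix_M2ns: "t \<in> hnf_index \<Longrightarrow> hnf_matrix t \<in> M2ns"
  using hnf_det_pos[of t] by (simp add: M2ns_def det_hnf_matrix)

lemma hnf_det_scale: "hnf_det (hnf_scale k t) = k ^ 2 * hnf_det t"
  by (cases t) (simp add: hnf_det_def hnf_scale_def power2_eq_square)

lemma primitive_hnf_matrix_iff:
  "primitive (hnf_matrix (a, d, b)) \<longleftrightarrow> gcd a (gcd d b) = 1"
proof
  let ?g = "gcd a (gcd d b)"
  have g: "?g dvd a" "?g dvd b" "?g dvd d"
    by (meson dvd_trans gcd_dvd1 gcd_dvd2)+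
  then have "\<forall>i j. int ?g dvd hnf_matrix (a, d, b) $ i $ j"
    by (simp only: hnf_matrix_def prod.case forall_2 vector_2 dvd_0_right int_dvd_int_iff simp_thms)
  then show "?g = 1" if "primitive (hnf_matrix (a, d, b))"
    using that unfolding primitive_iff by fastforce
next
  assume g: "gcd a (gcd d b) = 1"
  show "primitive (hnf_matrix (a, d, b))"
    unfolding primitive_iff
  proof (intro allI impI)
    fix k assume "\<forall>i j. k dvd hnf_matrix (a, d, b) $ i $ j"
    then have "k dvd int a" "k dvd int b" "k dvd int d"
      by (simp_all add: hnf_matrix_def forall_2)
    then have "k dvd gcd (int a) (gcd (int d) (int b))"
      by (intro gcd_greatest)
    then show "is_unit k"
      using g by (simp only: gcd_int_int_eq of_nat_1)
  qed
qed

text \<open>A unimodular matrix that carries one normal form to another is upper triangular with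
  positive diagonal, hence has diagonal \<open>1, 1\<close>; it can then only change \<open>b\<close> by a multiple
  of \<open>d\<close>, which the range \<open>0 \<le> b < d\<close> forbids.\<close>

lemma hnf_unique:
  assumes t: "t \<in> hnf_index" and t': "t' \<in> hnf_index"
    and rel: "(hnf_matrix t, hnf_matrix t') \<in> gl2_rel"
  shows "t = t'"
proof -
  obtain a d b where abd: "t = (a, d, b)" "0 < a" "0 < d" "b < d"
    using t by (auto simp: hnf_index_def)
  obtain a' d' b' where abd': "t' = (a', d', b')" "0 < a'" "0 < d'" "b' < d'"
    using t' by (auto simp: hnf_index_def)
  obtain U where U: "invertible U" "hnf_matrix t' = U ** hnf_matrix t"
    using rel by (auto simp: gl2_rel_def)
  have eqs: "int a' = U$1$1 * int a" "int b' = U$1$1 * int b + U$1$2 * int d"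
      "0 = U$2$1 * int a" "int d' = U$2$1 * int b + U$2$2 * int d"
    using U(2) by (auto simp: abd abd' hnf_matrix_def vec_eq_iff forall_2 matrix_matrix_mult_def sum_2)
  have u21: "U$2$1 = 0"
    using eqs(3) abd by simp
  have "\<bar>U$1$1 * U$2$2\<bar> = 1"
    using det_invertible_int[OF U(1)] by (simp add: det_eq u21)
  moreover have "0 < U$1$1"
    using eqs(1) abd abd' by (metis of_nat_0_less_iff zero_less_mult_pos2)
  moreover have "0 < U$2$2"
    using eqs(4) abd abd' u21 by (metis add_0 mult_zero_left of_nat_0_less_iff zero_less_mult_pos2)
  ultimately have u: "U$1$1 = 1" "U$2$2 = 1"
    by (auto simp: abs_mult zmult_eq_1_iff)
  have ad: "a' = a" "d' = d"
    using eqs u u21 by auto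
  have "int b' = int b + U$1$2 * int d"
    using eqs u by simp
  then have "int b' mod int d = int b mod int d"
    by simp
  then have "b' = b"
    using abd abd' ad by simp
  then show ?thesis
    using ad abd abd' by simp
qed

lemma bij_betw_big_picture:
  "bij_betw (\<lambda>t. gl2_rel `` {hnf_matrix t}) primitive_index big_picture"
proof (rule bij_betwI')
  fix t t' assume t: "t \<in> primitive_index" "t' \<in> primitive_index"
  then have h: "t \<in> hnf_index" "t' \<in> hnf_index"
    by (auto simp: primitive_index_def)
  show "(gl2_rel `` {hnf_matrix t} = gl2_rel `` {hnf_matrix t'}) = (t = t')"
    using hnf_unique[OF h] eq_equiv_class[OF _ equiv_gl2_rel hnf_matrix_M2ns[OF h(2)]] by blast
next
  fix t assume t: "t \<in> primitive_index"
  then have "hnf_matrix t \<in> M2ns" "primitive (hnf_matrix t)"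
    by (auto simp: primitive_index_def hnf_matrix_M2ns primitive_hnf_matrix_iff)
  then show "gl2_rel `` {hnf_matrix t} \<in> big_picture"
    unfolding big_picture_eq by blast
next
  fix x assume "x \<in> big_picture"
  then obtain A where A: "A \<in> M2ns" "primitive A" "x = gl2_rel `` {A}"
    unfolding big_picture_eq by blast
  obtain a b d where abd: "0 < a" "0 \<le> b" "b < d"
      "(A, vector [vector [a, b], vector [0, d]]) \<in> gl2_rel"
    using hermite_form[OF A(1)] by blast
  define t where "t = (nat a, nat d, nat b)"
  have m: "hnf_matrix t = vector [vector [a, b], vector [0, d]]"
    using abd by (simp add: t_def hnf_matrix_def)
  have "primitive (hnf_matrix t)"
    using primitive_gl2_rel[OF abd(4) A(2)] by (simp add: m)
  then have "t \<in> primitive_index"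
    using abd by (simp add: t_def primitive_index_def hnf_index_def primitive_hnf_matrix_iff)
  moreover have "x = gl2_rel `` {hnf_matrix t}"
    using abd(4) A(3) equiv_class_eq[OF equiv_gl2_rel] by (simp add: m)
  ultimately show "\<exists>t\<in>primitive_index. x = gl2_rel `` {hnf_matrix t}"
    by blast
qed

lemma class_det_hnf_matrix:
  "t \<in> hnf_index \<Longrightarrow> class_det (gl2_rel `` {hnf_matrix t}) = hnf_det t"
  by (simp add: class_det_eq hnf_matrix_M2ns det_hnf_matrix)

text \<open>The inverse map divides by the gcd of the three entries. The condition \<open>b < d\<close> is invariant
  under scaling, so normal forms go to normal forms in both directions.\<close>

lemma bij_betw_hnf_scale:
  "bij_betw (\<lambda>(k, t). hnf_scale k t) ({0<..} \<times> primitive_index) hnf_index"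
proof (rule bij_betw_byWitness[where f' =
      "\<lambda>(a, d, b). let g = gcd a (gcd d b) in (g, (a div g, d div g, b div g))"], goal_cases)
  case 1
  have "gcd (k * a) (gcd (k * d) (k * b)) = k" if "gcd a (gcd d b) = 1" for k a d b :: nat
    using that by (simp add: gcd_mult_distrib_nat [symmetric])
  then show ?case
    by (auto simp: primitive_index_def hnf_scale_def Let_def)
next
  case 2
  have "gcd a (gcd d b) dvd a" "gcd a (gcd d b) dvd d" "gcd a (gcd d b) dvd b" for a d b :: nat
    by (meson dvd_trans gcd_dvd1 gcd_dvd2)+
  then show ?case
    by (auto simp: hnf_scale_def Let_def)
next
  case 3
  show ?case
    by (auto simp: primitive_index_def hnf_index_def hnf_scale_def)
next
  case 4
  show ?case
  proof (rule image_subsetI)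
    fix t assume "t \<in> hnf_index"
    then obtain a d b where abd: "t = (a, d, b)" "0 < a" "0 < d" "b < d"
      by (auto simp: hnf_index_def)
    define g where "g = gcd a (gcd d b)"
    have g: "0 < g" "g dvd a" "g dvd d" "g dvd b"
      using abd unfolding g_def by (auto intro: dvd_trans[OF gcd_dvd2])
    then obtain a' d' b' where q: "a = g * a'" "d = g * d'" "b = g * b'"
      by (meson dvdE)
    have "g * gcd a' (gcd d' b') = g * 1"
      using g_def by (simp add: q gcd_mult_distrib_nat)
    then have "gcd a' (gcd d' b') = 1"
      using g(1) by simp
    then have "(g, (a div g, d div g, b div g)) \<in> {0<..} \<times> primitive_index"
      using abd g(1) by (simp add: q primitive_index_def hnf_index_def)
    then show "(case t of (a, d, b) \<Rightarrow> let g = gcd a (gcd d b) in (g, (a div g, d div g, b div g)))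
        \<in> {0<..} \<times> primitive_index"
      by (simp add: abd(1) g_def Let_def)
  qed
qed

section \<open>The formal Dirichlet series\<close>

text \<open>Since \<open>g 1 \<noteq> 0\<close>, the equation for the \<open>n\<close>-th coefficient of the product determines \<open>h n\<close>
  from the values of \<open>h\<close> at the proper divisors of \<open>n\<close>.\<close>

lemma dirichlet_divide_unique:
  assumes "g 1 \<noteq> 0" and mult: "\<And>n. n > 0 \<Longrightarrow> dirichlet_mult h g n = f n" and "n > 0"
  shows "h n = dirichlet_divide f g n"
  using \<open>n > 0\<close>
proof (induction n rule: less_induct)
  case (less n)
  have *: "{d. d dvd n} = insert n {d. d dvd n \<and> d < n}"
    using less.prems by (auto dest: dvd_imp_le intro: le_neq_trans)
  have "f n = h n * g 1 + (\<Sum>d | d dvd n \<and> d < n. h d * g (n div d))"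
    unfolding mult[OF less.prems, symmetric] dirichlet_mult_def * using less.prems
    by (subst sum.insert) auto
  also have "(\<Sum>d | d dvd n \<and> d < n. h d * g (n div d)) =
      (\<Sum>d | d dvd n \<and> d < n. dirichlet_divide f g d * g (n div d))"
    using less by (intro sum.cong refl) (auto intro!: Nat.gr0I)
  finally show ?case
    using \<open>g 1 \<noteq> 0\<close> by (simp add: dirichlet_divide.simps[of f g n])
qed

lemma hnf_det_level:
  assumes "n > 0"
  shows "finite {t \<in> hnf_index. hnf_det t = n}"
    and "card {t \<in> hnf_index. hnf_det t = n} = (\<Sum>a | a dvd n. n div a)"
proof -
  have eq: "{t \<in> hnf_index. hnf_det t = n} =
      (SIGMA a:{a. a dvd n}. (\<lambda>b. (n div a, b)) ` {..<n div a})"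
    using assms by (auto simp: hnf_index_def hnf_det_def image_iff dvd_div_eq_0_iff intro!: Nat.gr0I)
  show "finite {t \<in> hnf_index. hnf_det t = n}"
    unfolding eq using assms by (intro finite_SigmaI) auto
  show "card {t \<in> hnf_index. hnf_det t = n} = (\<Sum>a | a dvd n. n div a)"
    unfolding eq using assms by (subst card_SigmaI) (auto simp: card_image inj_on_def)
qed

lemma finite_square_roots: "finite {k::nat. k\<^sup>2 = m}"
  by (rule finite_subset[of _ "{..m}"]) (auto simp: power2_eq_square)

text \<open>The scaling bijection, restricted to determinant \<open>n\<close> and sorted by the determinant \<open>e\<close> of the
  primitive part; the number of square roots of \<open>n div e\<close> is the coefficient of the series
  of \<open>zeta(2s)\<close>.\<close>

lemma card_hnf_det_level_eq_sum_primitive: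
  assumes "n > 0"
  shows "card {t \<in> hnf_index. hnf_det t = n} =
    (\<Sum>e | e dvd n. card {t \<in> primitive_index. hnf_det t = e} * card {k::nat. k\<^sup>2 = n div e})"
proof -
  define S where "S = {(k, t) \<in> {0<..} \<times> primitive_index. k\<^sup>2 * hnf_det t = n}"
  define P where "P e = {t \<in> primitive_index. hnf_det t = e}" for e
  have sub: "primitive_index \<subseteq> hnf_index"
    by (auto simp: primitive_index_def)
  have finP: "finite (P e)" if "e > 0" for e
    using hnf_det_level(1)[OF that] by (rule rev_finite_subset) (use sub in \<open>auto simp: P_def\<close>)
  have "bij_betw (\<lambda>(k, t). hnf_scale k t) S {t \<in> hnf_index. hnf_det t = n}"
  proof (rule bij_betw_subset[OF bij_betw_hnf_scale])
    show "S \<subseteq> {0<..} \<times> primitive_index"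
      by (auto simp: S_def)
    show "(\<lambda>(k, t). hnf_scale k t) ` S = {t \<in> hnf_index. hnf_det t = n}"
      unfolding bij_betw_imp_surj_on[OF bij_betw_hnf_scale, symmetric] S_def
      by (force simp: hnf_det_scale)
  qed
  then have "card {t \<in> hnf_index. hnf_det t = n} = card S"
    by (simp add: bij_betw_same_card)
  also have "\<dots> = card (SIGMA e:{e. e dvd n}. P e \<times> {k::nat. k\<^sup>2 = n div e})"
  proof (rule bij_betw_same_card)
    have pos: "hnf_det t > 0" if "t \<in> primitive_index" for t
      using hnf_det_pos that sub by blast
    have k0: "k > 0" if "e dvd n" "k\<^sup>2 = n div e" for k e :: nat
      using that assms by (metis dvd_div_eq_0_iff neq0_conv power_zero_numeral)
    show "bij_betw (\<lambda>(k, t). (hnf_det t, (t, k))) S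
        (SIGMA e:{e. e dvd n}. P e \<times> {k::nat. k\<^sup>2 = n div e})"
      by (rule bij_betw_byWitness[where f' = "\<lambda>(e, t, k). (k, t)"])
        (use pos k0 in \<open>force simp: S_def P_def\<close>)+
  qed
  also have "\<dots> = (\<Sum>e | e dvd n. card (P e \<times> {k::nat. k\<^sup>2 = n div e}))"
  proof (rule card_SigmaI)
    show "finite {e. e dvd n}"
      using assms by simp
    show "\<forall>e\<in>{e. e dvd n}. finite (P e \<times> {k::nat. k\<^sup>2 = n div e})"
      using assms finP finite_square_roots by (auto intro!: finite_cartesian_product Nat.gr0I)
  qed
  finally show ?thesis
    by (simp add: card_cartesian_product P_def)
qed

lemma bij_betw_big_picture_level:
  "bij_betw (\<lambda>t. gl2_rel `` {hnf_matrix t}) {t \<in> primitive_index. hnf_det t = n}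
     {x \<in> big_picture. class_det x = n}"
proof (rule bij_betw_subset[OF bij_betw_big_picture])
  have "class_det (gl2_rel `` {hnf_matrix t}) = hnf_det t" if "t \<in> primitive_index" for t
    using that by (auto simp: primitive_index_def intro: class_det_hnf_matrix)
  then show "(\<lambda>t. gl2_rel `` {hnf_matrix t}) ` {t \<in> primitive_index. hnf_det t = n} =
      {x \<in> big_picture. class_det x = n}"
    unfolding bij_betw_imp_surj_on[OF bij_betw_big_picture, symmetric] by force
qed auto

lemma finite_big_picture_level:
  assumes "n > 0"
  shows "finite {x \<in> big_picture. class_det x = n}"
proof -
  have "finite {t \<in> primitive_index. hnf_det t = n}"
    using hnf_det_level(1)[OF assms] by (rule rev_finite_subset) (auto simp: primitive_index_def)
  then show ?thesis
    using bij_betw_finite[OF bij_betw_big_picture_level] by blast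
qed

lemma dirichlet_mult_big_picture_series:
  assumes "n > 0"
  shows "dirichlet_mult big_picture_series (dirichlet_scale 2 zeta_series) n =
    dirichlet_mult zeta_series (dirichlet_shift 1 zeta_series) n"
proof -
  have series: "big_picture_series e = of_nat (card {t \<in> primitive_index. hnf_det t = e})" for e
    unfolding big_picture_series_def using bij_betw_same_card[OF bij_betw_big_picture_level] by simp
  have scale: "dirichlet_scale 2 zeta_series m = of_nat (card {k::nat. k\<^sup>2 = m})" for m
    by (simp add: dirichlet_scale_def zeta_series_def)
  have "dirichlet_mult big_picture_series (dirichlet_scale 2 zeta_series) n =
      of_nat (card {t \<in> hnf_index. hnf_det t = n})"
    unfolding card_hnf_det_level_eq_sum_primitive[OF assms] dirichlet_mult_def series scale by simp
  also have "\<dots> = dirichlet_mult zeta_series (dirichlet_shift 1 zeta_series) n"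
    unfolding hnf_det_level(2)[OF assms]
    by (simp add: dirichlet_mult_def dirichlet_shift_def zeta_series_def)
  finally show ?thesis .
qed

section \<open>The sums as functions of a complex variable\<close>

lemma norm_of_nat_powr: "norm (of_nat n powr s :: complex) = real n powr Re s"
  by (cases "n = 0") (simp_all add: norm_powr_real_powr)

lemma of_nat_mult_powr:
  "(of_nat (m * n) powr s :: complex) = of_nat m powr s * of_nat n powr s"
  by (simp add: powr_times_real)

lemma of_nat_square_powr: "(of_nat (k\<^sup>2) powr (-s) :: complex) = of_nat k powr (- (2 * s))"
  unfolding power2_eq_square of_nat_mult_powr
  by (simp add: powr_add[symmetric] flip: mult_2)

lemma summable_norm_zeta_terms:
  assumes "Re s > 1"
  shows "summable (\<lambda>n. norm (of_nat (Suc n) powr (-s) :: complex))"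
  unfolding norm_of_nat_powr summable_Suc_iff[of "\<lambda>n. real n powr Re (-s)"]
  using assms by (simp add: summable_real_powr_iff)

text \<open>The form of the zeta series suited to rearrangement: an unordered sum over the positive
  integers.\<close>

lemma has_sum_zeta:
  assumes "Re s > 1"
  shows "((\<lambda>n. of_nat n powr (-s)) has_sum zeta s) {0<..}"
proof -
  let ?f = "\<lambda>n. of_nat (Suc n) powr (-s) :: complex"
  have "(?f has_sum zeta s) UNIV"
    unfolding zeta_def using summable_norm_zeta_terms[OF assms] summable_norm_cancel
    by (intro norm_summable_imp_has_sum summable_sums) auto
  moreover have "bij_betw Suc UNIV {0<..}"
    by (rule bij_betwI[of _ _ _ "\<lambda>n. n - 1"]) auto
  ultimately show ?thesis
    by (simp only: has_sum_reindex_bij_betw[of Suc UNIV "{0<..}" "\<lambda>n. of_nat n powr (-s)"])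
qed

text \<open>For complex families unordered summability is absolute summability, so the product family
  is dominated by the product of the norms.\<close>

lemma has_sum_product:
  fixes f :: "'a \<Rightarrow> complex" and g :: "'b \<Rightarrow> complex"
  assumes f: "(f has_sum S) A" and g: "(g has_sum T) B"
  shows "((\<lambda>(x, y). f x * g y) has_sum S * T) (A \<times> B)"
proof (rule has_sum_SigmaI)
  show "((\<lambda>y. case (x, y) of (x, y) \<Rightarrow> f x * g y) has_sum f x * T) B" for x
    using has_sum_cmult_right[OF g] by simp
  show "((\<lambda>x. f x * T) has_sum S * T) A"
    using f by (rule has_sum_cmult_left)
  have norms: "(\<lambda>x. norm (f x)) summable_on A" "(\<lambda>y. norm (g y)) summable_on B"
    using f g has_sum_imp_summable summable_on_iff_abs_summable_on_complex by blast+
  have "(\<lambda>(x, y). norm (f x) * norm (g y)) summable_on A \<times> B"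
  proof (rule summable_on_SigmaI)
    show "((\<lambda>y. case (x, y) of (x, y) \<Rightarrow> norm (f x) * norm (g y)) has_sum
        norm (f x) * (\<Sum>\<^sub>\<infinity>y\<in>B. norm (g y))) B" for x
      using has_sum_cmult_right[OF has_sum_infsum[OF norms(2)]] by simp
    show "(\<lambda>x. norm (f x) * (\<Sum>\<^sub>\<infinity>y\<in>B. norm (g y))) summable_on A"
      using norms(1) by (rule summable_on_cmult_left)
  qed auto
  then have "(\<lambda>z. norm (case z of (x, y) \<Rightarrow> f x * g y)) summable_on A \<times> B"
    by (simp add: case_prod_unfold norm_mult)
  then show "(\<lambda>(x, y). f x * g y) summable_on A \<times> B"
    by (rule abs_summable_summable)
qed

text \<open>The inner sum over \<open>b\<close> has \<open>d\<close> equal terms, which turns \<open>d powr (-s)\<close> into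
  \<open>d powr (1 - s)\<close>. This shift by \<open>1\<close> is what forces \<open>Re s > 2\<close>.\<close>

lemma has_sum_zeta_shift:
  assumes "Re s > 2"
  shows "((\<lambda>(d, b). of_nat d powr (-s)) has_sum zeta (s - 1)) (SIGMA d:{0<..}. {..<d::nat})"
proof (rule has_sum_SigmaI)
  show "((\<lambda>b. (case (d, b) of (d, b) \<Rightarrow> of_nat d powr (-s)) :: complex) has_sum
      of_nat d powr (- (s - 1))) {..<d}" if "d \<in> {0<..}" for d
    using that by (intro has_sum_finiteI) (simp_all add: powr_diff powr_minus field_simps)
  show "((\<lambda>d. of_nat d powr (- (s - 1))) has_sum zeta (s - 1)) {0<..}"
    by (rule has_sum_zeta) (use assms in simp)
  have "(\<lambda>(d, b). real d powr (- Re s)) summable_on (SIGMA d:{0<..}. {..<d})"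
  proof (rule summable_on_SigmaI)
    show "((\<lambda>b. case (d, b) of (d, b) \<Rightarrow> real d powr (- Re s)) has_sum
        real d powr (- (Re s - 1))) {..<d}" if "d \<in> {0<..}" for d
      using that by (intro has_sum_finiteI) (simp_all add: powr_diff powr_minus field_simps)
    have "(\<lambda>d. norm (of_nat d powr (- (s - 1)) :: complex)) summable_on {0<..}"
      using has_sum_imp_summable[OF has_sum_zeta[of "s - 1"]] assms
      by (subst summable_on_iff_abs_summable_on_complex[symmetric]) simp
    then show "(\<lambda>d. real d powr (- (Re s - 1))) summable_on {0<..}"
      by (simp add: norm_of_nat_powr)
  qed auto
  then have "(\<lambda>z. norm ((case z of (d, b) \<Rightarrow> of_nat d powr (-s)) :: complex))
      summable_on (SIGMA d:{0<..}. {..<d})"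
    by (simp add: case_prod_unfold norm_of_nat_powr)
  then show "(\<lambda>(d, b). of_nat d powr (-s)) summable_on (SIGMA d:{0<..}. {..<d})"
    by (rule abs_summable_summable)
qed

lemma has_sum_hnf_index:
  assumes "Re s > 2"
  shows "((\<lambda>t. of_nat (hnf_det t) powr (-s)) has_sum zeta s * zeta (s - 1)) hnf_index"
proof -
  have "((\<lambda>(a, d, b). of_nat a powr (-s) * of_nat d powr (-s)) has_sum zeta s * zeta (s - 1)) hnf_index"
    using has_sum_product[OF has_sum_zeta[of s] has_sum_zeta_shift[OF assms]] assms
    by (simp add: hnf_index_def case_prod_unfold)
  then show ?thesis
    by (simp only: hnf_det_def case_prod_unfold of_nat_mult_powr)
qed

text \<open>If \<open>zeta s\<close> were \<open>0\<close>, the terms with \<open>m \<ge> 2\<close> would sum to \<open>-1\<close>. But for these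
  \<open>1 / m ^ 3 \<le> 1 / (2 * (m - 1) * m)\<close>, and the right-hand side telescopes to \<open>1/2\<close>. The bound
  \<open>Re s \<ge> 3\<close> makes this crude estimate work, and it covers \<open>2 * s\<close> whenever \<open>Re s > 2\<close>.\<close>

lemma zeta_nonzero:
  assumes "Re s \<ge> 3"
  shows "zeta s \<noteq> 0"
proof
  assume zero: "zeta s = 0"
  let ?f = "\<lambda>n. of_nat (Suc n) powr (-s) :: complex"
  let ?g = "\<lambda>n. (inverse (real (Suc n)) - inverse (real (Suc (Suc n)))) / 2"
  have "summable (\<lambda>n. norm (?f n))"
    using assms by (intro summable_norm_zeta_terms) simp
  then have "?f sums 0"
    using zero summable_sums[OF summable_norm_cancel] unfolding zeta_def by metis
  then have tail: "(\<lambda>n. ?f (Suc n)) sums (-1)"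
    by (subst sums_Suc_iff) simp
  have g: "?g sums (1 / 2)"
    using sums_divide[OF telescope_sums'[OF LIMSEQ_inverse_real_of_nat], of 2] by simp
  have "norm (?f (Suc n)) \<le> ?g n" for n
  proof -
    have "norm (?f (Suc n)) = real (n + 2) powr (- Re s)"
      by (simp only: norm_of_nat_powr uminus_complex.sel) simp
    also have "\<dots> \<le> real (n + 2) powr (-3)"
      using assms by (intro powr_mono) auto
    also have "\<dots> = 1 / real (n + 2) ^ 3"
      by (simp add: powr_minus powr_numeral divide_simps)
    also have "\<dots> \<le> 1 / (2 * (real (n + 1) * real (n + 2)))"
    proof (rule divide_left_mono)
      have "2 * (real (n + 1) * real (n + 2)) \<le> real (n + 2) * (real (n + 2) * real (n + 2))"
        by (intro mult_mono) auto
      then show "2 * (real (n + 1) * real (n + 2)) \<le> real (n + 2) ^ 3"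
        by (simp add: power3_eq_cube)
    qed auto
    also have "\<dots> = ?g n"
      by (simp add: field_simps)
    finally show ?thesis .
  qed
  then have "norm (\<Sum>n. ?f (Suc n)) \<le> (\<Sum>n. ?g n)"
    using g by (intro norm_suminf_le) (auto simp: sums_iff)
  then show False
    using tail g by (simp add: sums_iff)
qed

text \<open>The sum over all normal forms is evaluated twice, once by \<open>has_sum_hnf_index\<close> and once
  through the scaling bijection. Summability over the big picture is inherited from the larger set
  of all normal forms.\<close>

lemma big_picture_zeta_factorization:
  assumes "Re s > 2"
  shows "(\<lambda>x. of_nat (class_det x) powr (-s) :: complex) summable_on big_picture"
    and "zeta (2 * s) * big_picture_zeta s = zeta s * zeta (s - 1)"
proof -
  let ?w = "\<lambda>t. of_nat (hnf_det t) powr (-s) :: complex"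
  let ?c = "\<lambda>x. of_nat (class_det x) powr (-s) :: complex"
  have sub: "primitive_index \<subseteq> hnf_index"
    by (auto simp: primitive_index_def)
  have "?w summable_on primitive_index"
    using has_sum_imp_summable[OF has_sum_hnf_index[OF assms]] sub by (rule summable_on_subset)
  then have "((\<lambda>t. ?c (gl2_rel `` {hnf_matrix t})) has_sum infsum ?w primitive_index) primitive_index"
    using sub by (subst has_sum_cong[where g = ?w]) (auto simp: class_det_hnf_matrix subset_iff)
  then have c: "(?c has_sum infsum ?w primitive_index) big_picture"
    by (simp only: has_sum_reindex_bij_betw[OF bij_betw_big_picture, of ?c])
  then show "?c summable_on big_picture"
    by (rule has_sum_imp_summable)
  have w: "(?w has_sum big_picture_zeta s) primitive_index"
    using c \<open>?w summable_on primitive_index\<close> by (simp add: big_picture_zeta_def infsumI)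
  have "((\<lambda>(k, t). of_nat k powr (- (2 * s)) * ?w t) has_sum zeta (2 * s) * big_picture_zeta s)
      ({0<..} \<times> primitive_index)"
    by (intro has_sum_product has_sum_zeta w) (use assms in simp)
  moreover have "(\<lambda>(k, t). of_nat k powr (- (2 * s)) * ?w t) = (\<lambda>z. ?w (case z of (k, t) \<Rightarrow> hnf_scale k t))"
    by (simp only: fun_eq_iff case_prod_unfold hnf_det_scale of_nat_mult_powr of_nat_square_powr) simp
  ultimately have "(?w has_sum zeta (2 * s) * big_picture_zeta s) hnf_index"
    by (simp only: has_sum_reindex_bij_betw[OF bij_betw_hnf_scale, of ?w])
  then show "zeta (2 * s) * big_picture_zeta s = zeta s * zeta (s - 1)"
    using has_sum_hnf_index[OF assms] has_sum_unique by blast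
qed

theorem proposition18:
  shows "(\<forall>n>0. finite {x \<in> big_picture. class_det x = n}
          \<and> big_picture_series n =
              dirichlet_divide (dirichlet_mult zeta_series (dirichlet_shift 1 zeta_series))
                (dirichlet_scale 2 zeta_series) n)
    \<and> (\<forall>s. Re s > 2 \<longrightarrow>
          (\<lambda>x. of_nat (class_det x) powr (-s) :: complex) summable_on big_picture
          \<and> zeta (2 * s) \<noteq> 0
          \<and> big_picture_zeta s = zeta s * zeta (s - 1) / zeta (2 * s))"
proof (intro conjI allI impI)
  fix n :: nat assume "n > 0"
  then show "finite {x \<in> big_picture. class_det x = n}"
    by (rule finite_big_picture_level)
  have "dirichlet_scale 2 zeta_series 1 \<noteq> 0"
    by (simp add: dirichlet_scale_def zeta_series_def)
  then show "big_picture_series n =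
      dirichlet_divide (dirichlet_mult zeta_series (dirichlet_shift 1 zeta_series))
        (dirichlet_scale 2 zeta_series) n"
    using dirichlet_mult_big_picture_series \<open>n > 0\<close> by (rule dirichlet_divide_unique)
next
  fix s :: complex assume s: "Re s > 2"
  show "(\<lambda>x. of_nat (class_det x) powr (-s) :: complex) summable_on big_picture"
    using s by (rule big_picture_zeta_factorization)
  show nz: "zeta (2 * s) \<noteq> 0"
    by (rule zeta_nonzero) (use s in simp)
  show "big_picture_zeta s = zeta s * zeta (s - 1) / zeta (2 * s)"
    using big_picture_zeta_factorization(2)[OF s] nz by (simp add: field_simps)
qed

end
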